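(* For all integers $m,n\ge 0$, $$\sum_{i=0}^{2^n-1}(-1)^{s_2(i)}i^{m+n}=(-1)^n(n+m)!\,2^{\frac{n(n-1)}{2}}\sum_{\substack{m=\nu_1+\ldots+\nu_t\\ \nu_1,\ldots,\nu_t\ge 1}}\left(\prod_{i=1}^t\frac{1}{(\nu_i+1)!}\right)\sum_{0\le l_1<\ldots<l_t\le n-1}2^{l_1\nu_1+\ldots+l_t\nu_t},$$ where the outer sum on the right is over all $t\ge 0$ and all tuples $(\nu_1,\ldots,\nu_t)$ of integers $\nu_i\ge 1$ with $\nu_1+\ldots+\nu_t=m$; for $m=0$ this outer sum is interpreted as $1$.
   Context: $s_2(i)$ denotes the sum of the binary digits of $i$. The convention $0^0=1$ is used. *)

theory Defs
  imports Complex_Main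
begin

fun s2 :: "nat \<Rightarrow> nat" where
  "s2 i = (if i = 0 then 0 else i mod 2 + s2 (i div 2))"

declare s2.simps [simp del]

text \<open>
  Tuples are lists indexed from 0. For \<open>m = 0\<close> the only composition is the empty list, so that
  a sum over \<open>compositions 0\<close> has the single term for \<open>t = 0\<close>.
\<close>
definition compositions :: "nat \<Rightarrow> nat list set" where
  "compositions m = {\<nu>. (\<forall>x\<in>set \<nu>. 1 \<le> x) \<and> sum_list \<nu> = m}"

text \<open>
  The tuples \<open>0 \<le> l\<^sub>1 < \<dots> < l\<^sub>t \<le> n - 1\<close>; the upper bound is written \<open>x < n\<close> because
  subtraction on \<open>nat\<close> truncates at \<open>n = 0\<close>.
\<close>
definition increasing_tuples :: "nat \<Rightarrow> nat \<Rightarrow> nat list set" where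
  "increasing_tuples t n = {l. length l = t \<and> sorted_wrt (<) l \<and> (\<forall>x\<in>set l. x < n)}"

lemma length_le_sum_list: "\<forall>x\<in>set \<nu>. 1 \<le> x \<Longrightarrow> length \<nu> \<le> sum_list (\<nu> :: nat list)"
  by (induction \<nu>) auto

lemma finite_compositions: "finite (compositions m)"
proof (rule finite_subset)
  show "compositions m \<subseteq> {\<nu>. set \<nu> \<subseteq> {..m} \<and> length \<nu> \<le> m}"
    using length_le_sum_list member_le_sum_list by (fastforce simp: compositions_def)
  show "finite {\<nu>. set \<nu> \<subseteq> {..m} \<and> length \<nu> \<le> m}"
    by (rule finite_lists_length_le) simp
qed

lemma compositions_0: "compositions 0 = {[]}"
proof -
  have "\<nu> = []" if "\<forall>x\<in>set \<nu>. 1 \<le> x" "sum_list \<nu> = 0" for \<nu> :: "nat list"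
    using length_le_sum_list[OF that(1)] that(2) by simp
  then show ?thesis
    by (auto simp: compositions_def)
qed

lemma increasing_tuples_0: "increasing_tuples 0 n = {[]}"
  by (auto simp: increasing_tuples_def)

lemma finite_increasing_tuples: "finite (increasing_tuples t n)"
proof (rule finite_subset)
  show "increasing_tuples t n \<subseteq> {l. set l \<subseteq> {..<n} \<and> length l = t}"
    by (auto simp: increasing_tuples_def)
  show "finite {l. set l \<subseteq> {..<n} \<and> length l = t}"
    by (rule finite_lists_length_eq) simp
qed

end

theory Submission
  imports Defs "HOL-Computational_Algebra.Formal_Power_Series"
begin

text \<open>
  Both sides are coefficients of one exponential generating function. Up to the factor
  \<open>(m + n)!\<close>, the left-hand side is the coefficient of \<open>X^(m + n)\<close> in the signed sum of the series
  \<open>exp (i X)\<close> over \<open>i < 2^n\<close>. Every such \<open>i\<close> is a sum of distinct powers of two, one for each binary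
  digit 1, and each of them contributes one sign, so the sum is the product of the
  \<open>1 - exp (2^j X)\<close> over \<open>j < n\<close> (\<open>thue_morse_fps_Suc\<close>).

  Each factor vanishes to first order: \<open>1 - exp (2^j X) = - 2^j X E\<^sub>j\<close>, where \<open>E\<^sub>j\<close> has the
  coefficients \<open>2^(j k) / (k + 1)!\<close> (\<open>one_minus_fps_exp\<close>). Collecting the monomials gives
  \<open>(-1)^n 2^(n (n - 1) / 2) X^n\<close> times the product of the \<open>E\<^sub>j\<close>. As every \<open>E\<^sub>j\<close> has constant term 1,
  a term of this product is determined by the indices \<open>l\<^sub>1 < \<dots> < l\<^sub>t\<close> of the factors from which a
  power \<open>\<nu>\<^sub>s \<ge> 1\<close> of \<open>X\<close> is taken, together with these powers. The coefficient of \<open>X^m\<close> is therefore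
  the double sum on the right-hand side (\<open>composition_fps_Suc\<close>).
\<close>

section \<open>The generating function of the signed powers\<close>

lemma s2_add_power2: "i < 2 ^ n \<Longrightarrow> s2 (i + 2 ^ n) = Suc (s2 i)"
proof (induction n arbitrary: i)
  case 0
  then show ?case by (simp add: s2.simps)
next
  case (Suc n)
  have "s2 (i + 2 ^ Suc n) = i mod 2 + s2 (i div 2 + 2 ^ n)"
    by (subst s2.simps) (simp add: add.commute)
  also have "\<dots> = Suc (i mod 2 + s2 (i div 2))"
    using Suc by simp
  also have "i mod 2 + s2 (i div 2) = s2 i"
    by (cases "i = 0") (simp_all add: s2.simps[of i] s2.simps[of 0])
  finally show ?case .
qed

definition thue_morse_fps :: "nat \<Rightarrow> real fps" where
  "thue_morse_fps n = (\<Sum>i<2 ^ n. fps_const ((-1) ^ s2 i) * fps_exp (real i))"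

lemma thue_morse_fps_nth:
  "fps_nth (thue_morse_fps n) p = (\<Sum>i<2 ^ n. (-1) ^ s2 i * real i ^ p) / fact p"
  by (simp add: thue_morse_fps_def fps_sum_nth sum_divide_distrib)

lemma thue_morse_fps_0: "thue_morse_fps 0 = 1"
  by (simp add: thue_morse_fps_def s2.simps)

text \<open>
  The indices below \<open>2^(n + 1)\<close> are the \<open>i\<close> and the \<open>i + 2^n\<close> with \<open>i < 2^n\<close>. The additional leading
  digit flips the sign and multiplies the exponential by \<open>exp (2^n X)\<close>.
\<close>
lemma thue_morse_fps_Suc:
  "thue_morse_fps (Suc n) = thue_morse_fps n * (1 - fps_exp (2 ^ n))"
proof -
  let ?f = "\<lambda>i. fps_const ((-1) ^ s2 i) * fps_exp (real i) :: real fps"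
  have split: "{..<2 ^ Suc n} = {..<2 ^ n} \<union> {2 ^ n..<2 ^ Suc n :: nat}"
    by auto
  have "(\<Sum>i\<in>{2 ^ n..<2 ^ Suc n}. ?f i) = (\<Sum>i<2 ^ n. ?f (i + 2 ^ n))"
    using sum.shift_bounds_nat_ivl[of ?f 0 "2 ^ n" "2 ^ n"] by (simp add: lessThan_atLeast0 mult_2)
  also have "\<dots> = (\<Sum>i<2 ^ n. - (?f i * fps_exp (2 ^ n)))"
    by (rule sum.cong)
       (simp_all add: s2_add_power2 fps_exp_add_mult mult.assoc flip: fps_const_neg)
  also have "\<dots> = - (thue_morse_fps n * fps_exp (2 ^ n))"
    by (simp only: thue_morse_fps_def sum_negf sum_distrib_right)
  finally have upper: "(\<Sum>i\<in>{2 ^ n..<2 ^ Suc n}. ?f i) = - (thue_morse_fps n * fps_exp (2 ^ n))" .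
  have "thue_morse_fps (Suc n) = (\<Sum>i<2 ^ n. ?f i) + (\<Sum>i\<in>{2 ^ n..<2 ^ Suc n}. ?f i)"
    unfolding thue_morse_fps_def split by (rule sum.union_disjoint) auto
  also have "\<dots> = thue_morse_fps n * (1 - fps_exp (2 ^ n))"
    unfolding upper by (simp add: thue_morse_fps_def right_diff_distrib)
  finally show ?thesis .
qed

section \<open>The generating function of the composition sums\<close>

text \<open>
  This is the series of \<open>(exp y - 1) / y\<close> at \<open>y = c X\<close>.
\<close>
definition exp_quotient_fps :: "real \<Rightarrow> real fps" where
  "exp_quotient_fps c = Abs_fps (\<lambda>k. c ^ k / fact (k + 1))"

lemma one_minus_fps_exp: "1 - fps_exp c = - fps_const c * fps_X * exp_quotient_fps c"
proof (rule fps_ext)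
  fix k
  show "fps_nth (1 - fps_exp c) k = fps_nth (- fps_const c * fps_X * exp_quotient_fps c) k"
    by (cases k) (simp_all add: exp_quotient_fps_def mult.assoc distrib_right flip: fps_const_neg)
qed

definition weighted_tuples :: "nat \<Rightarrow> nat \<Rightarrow> (nat list \<times> nat list) set" where
  "weighted_tuples n m = (SIGMA \<nu>:compositions m. increasing_tuples (length \<nu>) n)"

definition tuple_weight :: "nat list \<times> nat list \<Rightarrow> real" where
  "tuple_weight = (\<lambda>(\<nu>, l).
     (\<Prod>i<length \<nu>. 1 / fact (\<nu> ! i + 1)) * 2 ^ (\<Sum>i<length \<nu>. l ! i * \<nu> ! i))"

definition composition_fps :: "nat \<Rightarrow> real fps" where
  "composition_fps n = Abs_fps (\<lambda>m. \<Sum>x\<in>weighted_tuples n m. tuple_weight x)"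

lemma composition_fps_nth:
  "fps_nth (composition_fps n) m =
     (\<Sum>\<nu>\<in>compositions m. (\<Prod>i<length \<nu>. 1 / fact (\<nu> ! i + 1)) *
        (\<Sum>l\<in>increasing_tuples (length \<nu>) n. 2 ^ (\<Sum>i<length \<nu>. l ! i * \<nu> ! i)))"
  by (simp add: composition_fps_def weighted_tuples_def tuple_weight_def sum_distrib_left
      finite_compositions finite_increasing_tuples flip: sum.Sigma)

lemma finite_weighted_tuples: "finite (weighted_tuples n m)"
  by (simp add: weighted_tuples_def finite_compositions finite_increasing_tuples)

lemma weighted_tuples_length: "(\<nu>, l) \<in> weighted_tuples n m \<Longrightarrow> length l = length \<nu>"
  by (simp add: weighted_tuples_def increasing_tuples_def)

lemma tuple_weight_snoc:
  assumes "length l = length \<nu>"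
  shows "tuple_weight (\<nu> @ [k], l @ [j]) = tuple_weight (\<nu>, l) * (2 ^ (j * k) / fact (k + 1))"
proof -
  have "(\<Prod>i<length \<nu>. 1 / fact ((\<nu> @ [k]) ! i + 1)) = (\<Prod>i<length \<nu>. 1 / fact (\<nu> ! i + 1) :: real)"
    by (rule prod.cong) (simp_all add: nth_append)
  moreover have "(\<Sum>i<length \<nu>. (l @ [j]) ! i * (\<nu> @ [k]) ! i) = (\<Sum>i<length \<nu>. l ! i * \<nu> ! i)"
    using assms by (intro sum.cong) (simp_all add: nth_append)
  moreover have "(l @ [j]) ! length \<nu> = j"
    using assms by (metis nth_append_length)
  ultimately show ?thesis
    by (simp add: tuple_weight_def power_add)
qed

text \<open>
  Only the last index of an increasing tuple below \<open>n + 1\<close> can equal \<open>n\<close>. If it does, it is removed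
  together with the last part \<open>k\<close> of the composition, which leaves a composition of \<open>m - k\<close>.
\<close>
lemma weighted_tuples_Suc:
  "weighted_tuples (Suc n) m =
     weighted_tuples n m \<union>
     (\<lambda>(k, \<nu>, l). (\<nu> @ [k], l @ [n])) ` (SIGMA k:{1..m}. weighted_tuples n (m - k))"
  (is "?A = ?B \<union> ?h ` ?C")
proof (intro equalityI subsetI)
  fix x assume "x \<in> ?A"
  then obtain \<nu> l where x: "x = (\<nu>, l)" and \<nu>: "\<forall>a\<in>set \<nu>. 1 \<le> a" "sum_list \<nu> = m"
    and l: "length l = length \<nu>" "sorted_wrt (<) l" "\<forall>a\<in>set l. a < Suc n"
    by (auto simp: weighted_tuples_def compositions_def increasing_tuples_def)
  show "x \<in> ?B \<union> ?h ` ?C"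
  proof (cases "n \<in> set l")
    case False
    then have "\<forall>a\<in>set l. a < n"
      using l(3) by (metis less_antisym)
    then show ?thesis
      using x \<nu> l by (auto simp: weighted_tuples_def compositions_def increasing_tuples_def)
  next
    case True
    then have "l \<noteq> []" by auto
    then obtain l' j where l': "l = l' @ [j]" by (metis rev_exhaust)
    with \<open>l \<noteq> []\<close> l(1) obtain \<nu>' k where \<nu>': "\<nu> = \<nu>' @ [k]"
      by (metis length_0_conv rev_exhaust)
    have j: "j = n" and lt: "\<forall>a\<in>set l'. a < n"
      using l l' True by (force simp: sorted_wrt_append less_Suc_eq_le)+
    have "(k, \<nu>', l') \<in> ?C"
      using \<nu> l l' \<nu>' lt
      by (auto simp: weighted_tuples_def compositions_def increasing_tuples_def sorted_wrt_append)
    then have "?h (k, \<nu>', l') \<in> ?h ` ?C" by (rule imageI)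
    then show ?thesis using x l' \<nu>' j by simp
  qed
next
  fix x assume "x \<in> ?B \<union> ?h ` ?C"
  then show "x \<in> ?A"
    by (auto simp: weighted_tuples_def compositions_def increasing_tuples_def sorted_wrt_append
        intro: less_SucI)
qed

lemma composition_fps_0: "composition_fps 0 = 1"
proof (rule fps_ext)
  fix m
  have "weighted_tuples 0 m = (if m = 0 then {([], [])} else {})"
    by (auto simp: weighted_tuples_def increasing_tuples_def compositions_def)
  then show "fps_nth (composition_fps 0) m = fps_nth 1 m"
    by (simp add: composition_fps_def tuple_weight_def)
qed

text \<open>
  In the product, the constant term 1 of the new factor accounts for the tuples that avoid the index
  \<open>n\<close>, and its coefficient of \<open>X^k\<close> with \<open>k \<ge> 1\<close> for those in which \<open>n\<close> is paired with the part \<open>k\<close>.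
\<close>
lemma composition_fps_Suc:
  "composition_fps (Suc n) = composition_fps n * exp_quotient_fps (2 ^ n)"
proof (rule fps_ext)
  fix m
  let ?h = "\<lambda>(k, \<nu>, l). (\<nu> @ [k], l @ [n])"
  let ?C = "SIGMA k:{1..m}. weighted_tuples n (m - k)"
  let ?e = "\<lambda>k. 2 ^ (n * k) / fact (k + 1) :: real"
  let ?G = "\<lambda>m. \<Sum>x\<in>weighted_tuples n m. tuple_weight x"
  have disj: "weighted_tuples n m \<inter> ?h ` ?C = {}"
    by (auto simp: weighted_tuples_def increasing_tuples_def)
  have inj: "inj_on ?h ?C"
    by (auto simp: inj_on_def)
  have "fps_nth (composition_fps (Suc n)) m = ?G m + (\<Sum>x\<in>?h ` ?C. tuple_weight x)"
    using disj by (simp add: composition_fps_def weighted_tuples_Suc sum.union_disjoint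
        finite_weighted_tuples)
  also have "(\<Sum>x\<in>?h ` ?C. tuple_weight x) = (\<Sum>(k, x)\<in>?C. tuple_weight x * ?e k)"
    unfolding sum.reindex[OF inj] comp_def
    by (rule sum.cong) (auto simp: tuple_weight_snoc weighted_tuples_length)
  also have "\<dots> = (\<Sum>k=1..m. ?G (m - k) * ?e k)"
    by (simp add: sum_distrib_right sum_divide_distrib finite_weighted_tuples flip: sum.Sigma)
  also have "?G m + \<dots> = (\<Sum>k=0..m. ?G (m - k) * ?e k)"
    by (simp add: sum.atLeast_Suc_atMost)
  also have "\<dots> = fps_nth (exp_quotient_fps (2 ^ n) * composition_fps n) m"
    unfolding fps_mult_nth
    by (simp add: exp_quotient_fps_def composition_fps_def mult.commute flip: power_mult)
  finally show "fps_nth (composition_fps (Suc n)) m =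
      fps_nth (composition_fps n * exp_quotient_fps (2 ^ n)) m"
    by (simp only: mult.commute)
qed

section \<open>Comparison of the two generating functions\<close>

lemma thue_morse_fps_eq:
  "thue_morse_fps n =
     fps_const ((-1) ^ n * 2 ^ (n * (n - 1) div 2)) * fps_X ^ n * composition_fps n"
proof (induction n)
  case 0
  show ?case by (simp add: thue_morse_fps_0 composition_fps_0)
next
  case (Suc n)
  have exponent: "Suc n * (Suc n - 1) div 2 = n * (n - 1) div 2 + n"
  proof -
    have "Suc n * (Suc n - 1) = n * (n - 1) + n * 2"
      by (cases n) simp_all
    then show ?thesis by simp
  qed
  have const: "fps_const ((-1) ^ Suc n * 2 ^ (Suc n * (Suc n - 1) div 2)) =
      fps_const ((-1) ^ n * 2 ^ (n * (n - 1) div 2)) * (- fps_const (2 ^ n :: real))"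
    unfolding exponent by (simp add: power_add mult.assoc)
  show ?case
    unfolding thue_morse_fps_Suc Suc.IH one_minus_fps_exp composition_fps_Suc const
    by (simp only: power_Suc mult_ac)
qed

theorem corollary2p10:
  fixes m n :: nat
  shows "(\<Sum>i = 0..2 ^ n - 1. (-1) ^ s2 i * real i ^ (m + n)) =
    (-1) ^ n * fact (n + m) * 2 ^ (n * (n - 1) div 2) *
    (\<Sum>\<nu>\<in>compositions m.
      (\<Prod>i<length \<nu>. 1 / fact (\<nu> ! i + 1)) *
      (\<Sum>l\<in>increasing_tuples (length \<nu>) n. 2 ^ (\<Sum>i<length \<nu>. l ! i * \<nu> ! i)))"
proof -
  have range: "{0..2 ^ n - 1} = {..<2 ^ n :: nat}"
    by (auto simp: less_eq_iff_succ_less Suc_le_eq)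
  have "(\<Sum>i = 0..2 ^ n - 1. (-1) ^ s2 i * real i ^ (m + n)) =
      fact (n + m) * fps_nth (thue_morse_fps n) (m + n)"
    unfolding range by (simp add: thue_morse_fps_nth add.commute)
  also have "fps_nth (thue_morse_fps n) (m + n) =
      (-1) ^ n * 2 ^ (n * (n - 1) div 2) * fps_nth (composition_fps n) m"
    unfolding thue_morse_fps_eq by (simp add: mult.assoc fps_X_power_mult_nth)
  finally show ?thesis
    unfolding composition_fps_nth by (simp only: mult_ac)
qed

end
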